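(* Let $E\subset\mathbb{R}^n$ be open, let $L$ be a continuous vector field on $E$, let $q:E\to\mathbb{R}$ be continuous, and let $\eta\in C^1(E)$ be a solution of $(L+q)\psi=0$ on $E$ with no zeros in $E$. Then a function $\phi_0\in C^1(E)$ is a solution of $L\phi=0$ on $E$ if and only if $\psi_0=\eta\phi_0$ is a solution of $(L+q)\psi=0$ on $E$.
   Context: A continuous vector field $L=\sum_{k=1}^n a_k\,\partial/\partial x_k$ ($a_k\in C^0(E)$) acts on $C^1(E)$ by $L\psi=\sum_k a_k\,\partial\psi/\partial x_k$, and $(L+q)\psi=L\psi+q\psi$. Solutions are $C^1$ functions. *)

theory Defs
  imports "HOL-Analysis.Analysis"
begin

definition partial_deriv :: "'n::finite \<Rightarrow> (real^'n \<Rightarrow> real) \<Rightarrow> real^'n \<Rightarrow> real" where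
  "partial_deriv k f x = deriv (\<lambda>t. f (x + t *\<^sub>R axis k 1)) 0"

(* Functions on an open set E are represented by total functions of which only the values
   on E matter; the derivatives below depend only on these values because E is open. *)
definition C1_on :: "(real^'n::finite) set \<Rightarrow> (real^'n \<Rightarrow> real) \<Rightarrow> bool" where
  "C1_on E f \<longleftrightarrow>
    (\<exists>f' :: real^'n \<Rightarrow> ((real^'n) \<Rightarrow>\<^sub>L real).
      (\<forall>x\<in>E. (f has_derivative blinfun_apply (f' x)) (at x)) \<and> continuous_on E f')"

(* The field with coefficients a_k is the vector-valued map a with components a x $ k;
   continuity of a on E is continuity of all the a_k. *)
definition vf_op :: "(real^'n::finite \<Rightarrow> real^'n) \<Rightarrow> (real^'n \<Rightarrow> real) \<Rightarrow> real^'n \<Rightarrow> real" where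
  "vf_op a \<psi> x = (\<Sum>k\<in>UNIV. a x $ k * partial_deriv k \<psi> x)"

definition vf_plus_op ::
  "(real^'n::finite \<Rightarrow> real^'n) \<Rightarrow> (real^'n \<Rightarrow> real) \<Rightarrow> (real^'n \<Rightarrow> real) \<Rightarrow> real^'n \<Rightarrow> real" where
  "vf_plus_op a q \<psi> x = vf_op a \<psi> x + q x * \<psi> x"

definition is_solution_on ::
  "(real^'n::finite) set \<Rightarrow> ((real^'n \<Rightarrow> real) \<Rightarrow> real^'n \<Rightarrow> real) \<Rightarrow> (real^'n \<Rightarrow> real) \<Rightarrow> bool" where
  "is_solution_on E T \<psi> \<longleftrightarrow> C1_on E \<psi> \<and> (\<forall>x\<in>E. T \<psi> x = 0)"

end

theory Submission
  imports Defs
begin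

text \<open>
  At a point of differentiability, \<open>L\<psi>\<close> is the derivative of \<open>\<psi>\<close> applied to the vector \<open>a x\<close>
  (\<open>vf_op_has_derivative\<close>), so \<open>L\<close> inherits the Leibniz rule from the total derivative. Hence
  \<open>(L + q)(\<eta>\<phi>) = \<eta> L\<phi> + \<phi> (L + q)\<eta>\<close>
  (\<open>vf_plus_op_mult\<close>), and the last summand vanishes when \<open>\<eta>\<close> solves \<open>(L + q)\<psi> = 0\<close>. Since
  \<open>\<eta>\<close> has no zeros, the left-hand side vanishes exactly where \<open>L\<phi>\<close> does. The regularity part
  of being a solution transfers because a product of \<open>C\<^sup>1\<close> functions is \<open>C\<^sup>1\<close>.
\<close>

lemma partial_deriv_has_derivative:
  fixes f :: "real^'n::finite \<Rightarrow> real"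
  assumes "(f has_derivative D) (at x)"
  shows "partial_deriv k f x = D (axis k 1)"
proof -
  have "(f has_derivative D) (at (x + 0 *\<^sub>R axis k 1))"
    using assms by simp
  moreover have "((\<lambda>t::real. x + t *\<^sub>R axis k 1) has_derivative (\<lambda>t. t *\<^sub>R axis k 1)) (at 0)"
    by (auto intro!: derivative_eq_intros)
  ultimately have "((\<lambda>t. f (x + t *\<^sub>R axis k 1)) has_derivative (\<lambda>t. D (t *\<^sub>R axis k 1))) (at 0)"
    using has_derivative_compose[of "\<lambda>t::real. x + t *\<^sub>R axis k 1" _ 0 UNIV f D] by simp
  moreover have "(\<lambda>t. D (t *\<^sub>R axis k 1)) = (*) (D (axis k 1))"
    using linear_scale[OF has_derivative_linear[OF assms]] by (simp add: fun_eq_iff mult.commute)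
  ultimately have "((\<lambda>t. f (x + t *\<^sub>R axis k 1)) has_field_derivative D (axis k 1)) (at 0)"
    by (simp add: has_field_derivative_def)
  then show ?thesis
    unfolding partial_deriv_def by (rule DERIV_imp_deriv)
qed

text \<open>
  Expanding \<open>a x\<close> in the standard basis turns the coordinate form of \<open>L\<close> into a form free of
  partial derivatives, to which the product rule for total derivatives applies directly.
\<close>

lemma vf_op_has_derivative:
  fixes f :: "real^'n::finite \<Rightarrow> real"
  assumes "(f has_derivative D) (at x)"
  shows "vf_op a f x = D (a x)"
proof -
  have lin: "linear D"
    using assms by (rule has_derivative_linear)
  have "D (a x) = D (\<Sum>k\<in>UNIV. (a x $ k) *\<^sub>R axis k 1)"
    using basis_expansion[of "a x"] by (simp add: scalar_mult_eq_scaleR)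
  also have "\<dots> = (\<Sum>k\<in>UNIV. a x $ k * D (axis k 1))"
    by (simp add: linear_sum[OF lin] linear_scale[OF lin])
  finally show ?thesis
    by (simp add: vf_op_def partial_deriv_has_derivative[OF assms])
qed

lemma C1_on_imp_differentiable:
  assumes "C1_on E f" "x \<in> E"
  shows "f differentiable (at x)"
  using assms unfolding C1_on_def differentiable_def by blast

lemma C1_on_imp_continuous_on: "C1_on E f \<Longrightarrow> continuous_on E f"
  by (rule continuous_at_imp_continuous_on)
    (blast dest: C1_on_imp_differentiable intro: differentiable_imp_continuous_within)

lemma C1_on_mult:
  assumes "C1_on E f" "C1_on E g"
  shows "C1_on E (\<lambda>x. f x * g x)"
proof -
  obtain f' where f': "\<And>x. x \<in> E \<Longrightarrow> (f has_derivative blinfun_apply (f' x)) (at x)"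
    and cf': "continuous_on E f'"
    using assms(1) unfolding C1_on_def by blast
  obtain g' where g': "\<And>x. x \<in> E \<Longrightarrow> (g has_derivative blinfun_apply (g' x)) (at x)"
    and cg': "continuous_on E g'"
    using assms(2) unfolding C1_on_def by blast
  let ?D = "\<lambda>x. f x *\<^sub>R g' x + g x *\<^sub>R f' x"
  have "((\<lambda>x. f x * g x) has_derivative blinfun_apply (?D x)) (at x)" if "x \<in> E" for x
    using has_derivative_mult[OF f'[OF that] g'[OF that]]
    by (simp add: plus_blinfun.rep_eq scaleR_blinfun.rep_eq mult.commute)
  moreover have "continuous_on E ?D"
    by (intro continuous_intros cf' cg' C1_on_imp_continuous_on assms)
  ultimately show ?thesis
    unfolding C1_on_def by (intro exI[of _ ?D] conjI ballI)
qed

text \<open>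
  The zeroth-order term \<open>q f g\<close> goes entirely with the factor \<open>f\<close>, which leaves \<open>g\<close> acted on by
  \<open>L\<close> alone; this is what trades \<open>L + q\<close> for \<open>L\<close> once \<open>f\<close> is a solution.
\<close>

lemma vf_plus_op_mult:
  fixes f g :: "real^'n::finite \<Rightarrow> real"
  assumes "f differentiable (at x)" "g differentiable (at x)"
  shows "vf_plus_op a q (\<lambda>x. f x * g x) x = f x * vf_op a g x + g x * vf_plus_op a q f x"
proof -
  obtain F G where F: "(f has_derivative F) (at x)" and G: "(g has_derivative G) (at x)"
    using assms unfolding differentiable_def by blast
  show ?thesis
    unfolding vf_plus_op_def vf_op_has_derivative[OF has_derivative_mult[OF F G]]
      vf_op_has_derivative[OF F] vf_op_has_derivative[OF G]
    by (simp add: algebra_simps)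
qed

theorem mainTheorem8:
  fixes E :: "(real^'n::finite) set"
    and a :: "real^'n \<Rightarrow> real^'n"
    and q \<eta> \<phi>0 :: "real^'n \<Rightarrow> real"
  assumes "open E"
    and "continuous_on E a"
    and "continuous_on E q"
    and "is_solution_on E (vf_plus_op a q) \<eta>"
    and "\<forall>x\<in>E. \<eta> x \<noteq> 0"
    and "C1_on E \<phi>0"
  shows "is_solution_on E (vf_op a) \<phi>0 \<longleftrightarrow>
         is_solution_on E (vf_plus_op a q) (\<lambda>x. \<eta> x * \<phi>0 x)"
proof -
  have \<eta>: "C1_on E \<eta>" "\<And>x. x \<in> E \<Longrightarrow> vf_plus_op a q \<eta> x = 0"
    using assms(4) unfolding is_solution_on_def by auto
  have "vf_plus_op a q (\<lambda>x. \<eta> x * \<phi>0 x) x = \<eta> x * vf_op a \<phi>0 x" if "x \<in> E" for x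
    using vf_plus_op_mult[OF C1_on_imp_differentiable[OF \<eta>(1) that]
        C1_on_imp_differentiable[OF assms(6) that], of a q] \<eta>(2)[OF that] by simp
  then show ?thesis
    using assms(5,6) C1_on_mult[OF \<eta>(1) assms(6)] by (simp add: is_solution_on_def)
qed

end
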